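(* Let $M\ge1$ and let $x_0,\dots,x_{M-1}\in\mathbb{R}$ have exactly $P\ge1$ non-zero discrete Fourier coefficients, at indices $0\le i_0<i_1<\dots<i_{P-1}\le M-1$, and let $\omega=e^{-j2\pi/M}$, $j=\sqrt{-1}$. Let $L=P-1$ and let $\mathbf{K}=(K_0,\dots,K_{P-1})^\top$ be the unique vector satisfying $$\sum_{l=0}^{P-1}\omega^{-l i_p}K_l=\omega^{i_p},\qquad p=0,\dots,P-1 .$$ Then for $1\le m\le P$, $$K_{m-1}=\sum_{n=1}^{P}(-1)^{m+1}\,\frac{\displaystyle\sum_{\substack{0\le k_1<\dots<k_{P-m}\le P-1\\ k_1,\dots,k_{P-m}\ne n-1}}\omega^{-(i_{k_1}+\dots+i_{k_{P-m}})}}{\displaystyle\prod_{\substack{0\le l\le P-1\\ l\ne n-1}}\left(\omega^{-i_l}-\omega^{-i_{n-1}}\right)}\;\omega^{i_{n-1}} .$$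
   Context: The Fourier coefficients are $a_i=\frac1M\sum_{k=0}^{M-1}x_k e^{j2\pi ki/M}$, $0\le i\le M-1$. The linear system in the claim is the spectral-domain form of the requirement that the linear model with $P-1$ time delays predicts the data perfectly: $x_{(k+1)\bmod M}=\sum_{l=0}^{P-1}K_l x_{(k-l)\bmod M}$ for all $k$. Empty products, and the sum over the empty tuple when $m=P$, equal $1$. *)

theory Defs
  imports Complex_Main "HOL-Library.FuncSet"
begin

text \<open>Positive exponent and normalisation by \<open>1/M\<close>, hence not the usual forward transform.\<close>

definition fourier_coeff :: "nat \<Rightarrow> (nat \<Rightarrow> real) \<Rightarrow> nat \<Rightarrow> complex" where
  "fourier_coeff M x r =
     1 / of_nat M * (\<Sum>k<M. of_real (x k) * exp (\<i> * 2 * of_real pi * of_nat k * of_nat r / of_nat M))"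

definition omega :: "nat \<Rightarrow> complex" where
  "omega M = exp (- (\<i> * 2 * of_real pi / of_nat M))"

definition spectral_system :: "nat \<Rightarrow> nat \<Rightarrow> (nat \<Rightarrow> nat) \<Rightarrow> (nat \<Rightarrow> complex) \<Rightarrow> bool" where
  "spectral_system M P i K \<longleftrightarrow>
     (\<forall>p<P. (\<Sum>l<P. omega M powi (- (int l * int (i p))) * K l) = omega M ^ i p)"

text \<open>A tuple \<open>k\<^sub>1 < \<dots> < k\<^sub>q\<close> is a strictly sorted list of length \<open>q\<close>;
  for \<open>q = 0\<close> the only tuple is the empty list.\<close>

definition increasing_tuples :: "nat \<Rightarrow> nat set \<Rightarrow> nat list set" where
  "increasing_tuples q A = {ks. length ks = q \<and> sorted_wrt (<) ks \<and> set ks \<subseteq> A}"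

lemma finite_increasing_tuples: "finite A \<Longrightarrow> finite (increasing_tuples q A)"
  by (rule finite_subset[OF _ finite_lists_length_eq[of A q]]) (auto simp: increasing_tuples_def)

end

theory Submission
  imports Defs "HOL-Computational_Algebra.Polynomial"
begin

text \<open>Put \<open>z p = \<omega> ^ (- i p)\<close>. These nodes are distinct, and the spectral system says that the
  polynomial with coefficients \<open>K l\<close> takes the value \<open>\<omega> ^ i p\<close> at \<open>z p\<close>. It is therefore the
  Lagrange interpolation polynomial, and expanding the Lagrange basis by Vieta's formula gives
  the coefficients. Reversing the \<open>P - 1\<close> factors of each Lagrange denominator turns Vieta's
  sign \<open>(-1) ^ (P - m)\<close> into \<open>(-1) ^ (m + 1)\<close>.\<close>

text \<open>Vieta's formula. Multiplying out means choosing a set \<open>X\<close> of factors that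
  contribute their constant \<open>- z a\<close>; the other factors contribute the variable, so
  \<open>X\<close> yields a monomial of degree \<open>card A - card X\<close>.\<close>

lemma coeff_prod_monic_linear:
  fixes z :: "'a \<Rightarrow> 'b::comm_ring_1"
  assumes "finite A" and "r \<le> card A"
  shows "coeff (\<Prod>a\<in>A. [:- z a, 1:]) r =
    (-1) ^ (card A - r) * (\<Sum>X\<in>{X. X \<subseteq> A \<and> card X = card A - r}. \<Prod>a\<in>X. z a)"
proof -
  have "(\<Prod>a\<in>A. [:- z a, 1:]) = (\<Prod>a\<in>A. [:- z a:] + monom 1 1)"
    by (simp add: monom_altdef)
  also have "\<dots> = (\<Sum>X\<in>Pow A. (\<Prod>a\<in>X. [:- z a:]) * (\<Prod>a\<in>A - X. monom 1 1))"
    using assms(1) by (rule prod_add)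
  also have "\<dots> = (\<Sum>X\<in>Pow A. monom ((-1) ^ card X * (\<Prod>a\<in>X. z a)) (card A - card X))"
  proof (rule sum.cong[OF refl])
    fix X assume X: "X \<in> Pow A"
    have fin: "finite X" using X assms(1) finite_subset by auto
    have "(\<Prod>a\<in>X. [:- z a:]) = [:\<Prod>a\<in>X. - z a:]"
      using fin by (induction X rule: finite_induct) (auto simp: one_pCons)
    moreover have "(\<Prod>a\<in>X. - z a) = (-1) ^ card X * (\<Prod>a\<in>X. z a)"
      by (rule prod_uminus)
    moreover have "card (A - X) = card A - card X"
      using X fin by (simp add: card_Diff_subset)
    ultimately show "(\<Prod>a\<in>X. [:- z a:]) * (\<Prod>a\<in>A - X. monom 1 1) =
        monom ((-1) ^ card X * (\<Prod>a\<in>X. z a)) (card A - card X)"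
      by (simp add: monom_power smult_monom)
  qed
  finally have "coeff (\<Prod>a\<in>A. [:- z a, 1:]) r =
      (\<Sum>X\<in>Pow A. if card A - card X = r then (-1) ^ card X * (\<Prod>a\<in>X. z a) else 0)"
    by (simp add: coeff_sum)
  also have "\<dots> = (\<Sum>X\<in>{X \<in> Pow A. card A - card X = r}. (-1) ^ card X * (\<Prod>a\<in>X. z a))"
    using assms(1) by (intro sum.inter_filter[symmetric]) simp
  \<comment> \<open>Both \<open>r\<close> and \<open>card X\<close> are at most
    \<open>card A\<close>, so truncated subtraction loses nothing here.\<close>
  also have "{X \<in> Pow A. card A - card X = r} = {X. X \<subseteq> A \<and> card X = card A - r}"
    using assms card_mono[OF assms(1)] by fastforce
  finally show ?thesis by (simp add: sum_distrib_left)
qed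

text \<open>\<open>set\<close> and \<open>sorted_list_of_set\<close> are mutually inverse between
  strictly sorted lists and finite sets. This turns the subsets in Vieta's formula into the tuples
  of the theorem.\<close>

lemma sum_increasing_tuples:
  assumes "finite A"
  shows "(\<Sum>ks\<in>increasing_tuples q A. f (set ks)) = (\<Sum>X\<in>{X. X \<subseteq> A \<and> card X = q}. f X)"
proof (rule sum.reindex_bij_witness[where i = sorted_list_of_set and j = set])
  fix ks assume "ks \<in> increasing_tuples q A"
  then show "sorted_list_of_set (set ks) = ks" "set ks \<in> {X. X \<subseteq> A \<and> card X = q}"
    by (auto simp: increasing_tuples_def strict_sorted_iff distinct_card
        sorted_list_of_set.idem_if_sorted_distinct)
next
  fix X assume "X \<in> {X. X \<subseteq> A \<and> card X = q}"
  then show "set (sorted_list_of_set X) = X" "sorted_list_of_set X \<in> increasing_tuples q A"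
    using finite_subset[OF _ assms] by (auto simp: increasing_tuples_def)
qed simp

text \<open>Each basis polynomial is a scalar times a product of monic linear factors, the shape to
  which \<open>coeff_prod_monic_linear\<close> applies.\<close>

definition lagrange :: "'a set \<Rightarrow> ('a \<Rightarrow> 'b::field) \<Rightarrow> ('a \<Rightarrow> 'b) \<Rightarrow> 'b poly" where
  "lagrange A z y =
    (\<Sum>n\<in>A. smult (y n / (\<Prod>l\<in>A - {n}. z n - z l)) (\<Prod>l\<in>A - {n}. [:- z l, 1:]))"

lemma poly_lagrange:
  assumes "finite A" and "inj_on z A" and "p \<in> A"
  shows "poly (lagrange A z y) (z p) = y p"
proof -
  have "poly (lagrange A z y) (z p) =
      (\<Sum>n\<in>A. y n / (\<Prod>l\<in>A - {n}. z n - z l) * (\<Prod>l\<in>A - {n}. z p - z l))"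
    by (simp add: lagrange_def poly_sum poly_prod)
  also have "\<dots> = (\<Sum>n\<in>A. if n = p then y n else 0)"
  proof (rule sum.cong[OF refl])
    fix n assume "n \<in> A"
    show "y n / (\<Prod>l\<in>A - {n}. z n - z l) * (\<Prod>l\<in>A - {n}. z p - z l) = (if n = p then y n else 0)"
    proof (cases "n = p")
      case True
      have "(\<Prod>l\<in>A - {p}. z p - z l) \<noteq> 0"
        using assms by (auto simp: prod_zero_iff dest: inj_onD)
      with True show ?thesis by simp
    next
      case False
      then have "(\<Prod>l\<in>A - {n}. z p - z l) = 0"
        using assms by (auto simp: prod_zero_iff)
      with False show ?thesis by simp
    qed
  qed
  finally show ?thesis using assms by simp
qed

lemma degree_lagrange_less:
  assumes "finite A" and "A \<noteq> {}"
  shows "degree (lagrange A z y) < card A"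
  unfolding lagrange_def
proof (rule degree_sum_less)
  show "card A > 0" using assms by (simp add: card_gt_0_iff)
  fix n assume "n \<in> A"
  have "degree (\<Prod>l\<in>A - {n}. [:- z l, 1:]) = card (A - {n})"
    by (subst degree_prod_sum_eq) auto
  also have "\<dots> < card A" using assms(1) \<open>n \<in> A\<close> by (rule card_Diff1_less)
  finally show "degree (smult (y n / (\<Prod>l\<in>A - {n}. z n - z l)) (\<Prod>l\<in>A - {n}. [:- z l, 1:])) < card A"
    using degree_smult_le le_less_trans by blast
qed

lemma coeff_lagrange:
  fixes z :: "nat \<Rightarrow> 'b::field"
  assumes "finite A" and "r < card A"
  shows "coeff (lagrange A z y) r =
    (\<Sum>n\<in>A. (-1) ^ r * ((\<Sum>ks\<in>increasing_tuples (card A - Suc r) (A - {n}). \<Prod>k\<in>set ks. z k) /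
      (\<Prod>l\<in>A - {n}. z l - z n)) * y n)"
  unfolding lagrange_def coeff_sum coeff_smult
proof (rule sum.cong[OF refl])
  fix n assume n: "n \<in> A"
  \<comment> \<open>Reversing the \<open>card A - 1\<close> differences in the denominator costs one
    sign each. This splitting separates the surviving \<open>(-1) ^ r\<close> from the part that
    cancels Vieta's sign.\<close>
  have card: "card (A - {n}) = r + (card A - Suc r)" 
    using assms n by (simp add: card_Diff_singleton)
  have "(\<Prod>l\<in>A - {n}. z n - z l) = (\<Prod>l\<in>A - {n}. - (z l - z n))"
    by simp
  also have "\<dots> = (-1) ^ card (A - {n}) * (\<Prod>l\<in>A - {n}. z l - z n)"
    by (rule prod_uminus)
  also have "(-1::'b) ^ card (A - {n}) = (-1) ^ r * (-1) ^ (card A - Suc r)"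
    by (simp only: card power_add)
  finally have den: "(\<Prod>l\<in>A - {n}. z n - z l) =
      (-1) ^ r * (-1) ^ (card A - Suc r) * (\<Prod>l\<in>A - {n}. z l - z n)" .
  have num: "coeff (\<Prod>l\<in>A - {n}. [:- z l, 1:]) r = (-1) ^ (card A - Suc r) *
      (\<Sum>ks\<in>increasing_tuples (card A - Suc r) (A - {n}). \<Prod>k\<in>set ks. z k)"
    using assms(1) card
    by (subst coeff_prod_monic_linear) (auto simp: sum_increasing_tuples)
  show "y n / (\<Prod>l\<in>A - {n}. z n - z l) * coeff (\<Prod>l\<in>A - {n}. [:- z l, 1:]) r =
      (-1) ^ r * ((\<Sum>ks\<in>increasing_tuples (card A - Suc r) (A - {n}). \<Prod>k\<in>set ks. z k) /
        (\<Prod>l\<in>A - {n}. z l - z n)) * y n"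
    unfolding den num by (cases "even r"; cases "even (card A - Suc r)") simp_all
qed

text \<open>The left side says that the polynomial with coefficients \<open>K\<close> interpolates
  \<open>y\<close> at the nodes. As an equivalence, this yields existence, uniqueness and the value
  of the solution together.\<close>

lemma vandermonde_system_iff_coeff_lagrange:
  fixes z :: "nat \<Rightarrow> 'b::field"
  assumes "inj_on z {..<P}" and "P > 0"
  shows "(\<forall>p<P. (\<Sum>l<P. z p ^ l * K l) = y p) \<longleftrightarrow> (\<forall>l<P. K l = coeff (lagrange {..<P} z y) l)"
proof
  let ?L = "lagrange {..<P} z y" and ?Q = "\<Sum>l<P. monom (K l) l"
  have deg: "degree ?L < P"
    using degree_lagrange_less[of "{..<P}" z y] assms(2) by (auto simp: lessThan_empty_iff)
  have "degree ?Q < P"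
    using assms(2) by (intro degree_sum_less) (auto intro: le_less_trans[OF degree_monom_le])
  moreover assume *: "\<forall>p<P. (\<Sum>l<P. z p ^ l * K l) = y p"
  \<comment> \<open>Two polynomials of degree below \<open>P\<close> that agree at \<open>P\<close>
    distinct nodes coincide.\<close>
  ultimately have "?Q = ?L"
    using deg assms(1)
    by (intro poly_eqI_degree[where A = "z ` {..<P}"])
       (auto simp: card_image poly_lagrange poly_sum poly_monom mult.commute)
  then show "\<forall>l<P. K l = coeff ?L l"
    by (auto simp: coeff_sum simp flip: \<open>?Q = ?L\<close>)
next
  let ?L = "lagrange {..<P} z y"
  assume *: "\<forall>l<P. K l = coeff ?L l"
  have deg: "degree ?L \<le> P - 1"
    using degree_lagrange_less[of "{..<P}" z y] assms(2) by (auto simp: lessThan_empty_iff)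
  have "?L = (\<Sum>l\<le>P - 1. monom (coeff ?L l) l)"
    using poly_as_sum_of_monoms'[OF deg] by simp
  also have "\<dots> = (\<Sum>l<P. monom (K l) l)"
    using * assms(2) by (intro sum.cong) auto
  finally have L: "?L = (\<Sum>l<P. monom (K l) l)" .
  show "\<forall>p<P. (\<Sum>l<P. z p ^ l * K l) = y p"
  proof (intro allI impI)
    fix p assume "p < P"
    then have "y p = poly ?L (z p)" using assms(1) by (simp add: poly_lagrange)
    also have "\<dots> = (\<Sum>l<P. z p ^ l * K l)"
      by (subst L) (simp add: poly_sum poly_monom mult.commute)
    finally show "(\<Sum>l<P. z p ^ l * K l) = y p" by simp
  qed
qed

text \<open>The powers are the inverses of the \<open>M\<close> distinct \<open>M\<close>-th roots
  of unity.\<close>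

lemma inj_on_omega_power:
  assumes "M \<ge> 1"
  shows "inj_on (\<lambda>r. omega M ^ r) {..<M}"
proof -
  have "inj_on (\<lambda>r. cis (2 * pi * real r / real M)) {..<M}"
    using bij_betw_roots_unity[of M] assms by (simp add: bij_betw_def)
  moreover have "omega M ^ r = inverse (cis (2 * pi * real r / real M))" for r
    by (simp add: omega_def cis_conv_exp mult_ac flip: exp_of_nat_mult exp_minus)
  ultimately show ?thesis by (simp only: inj_on_def inverse_eq_iff_eq)
qed

theorem mainTheorem4:
  fixes M P :: nat and x :: "nat \<Rightarrow> real" and i :: "nat \<Rightarrow> nat"
  assumes "M \<ge> 1" and "P \<ge> 1"
    and "strict_mono_on {..<P} i"
    and "i ` {..<P} = {r. r < M \<and> fourier_coeff M x r \<noteq> 0}"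
  shows "(\<exists>!K. K \<in> {..<P} \<rightarrow>\<^sub>E (UNIV :: complex set) \<and> spectral_system M P i K) \<and>
    (\<forall>K. spectral_system M P i K \<longrightarrow>
      (\<forall>m\<in>{1..P}. K (m - 1) =
        (\<Sum>n=1..P. (-1) ^ (m + 1) *
          ((\<Sum>ks\<in>increasing_tuples (P - m) ({..<P} - {n - 1}).
              omega M powi (- (\<Sum>k\<leftarrow>ks. int (i k)))) /
           (\<Prod>l\<in>{..<P} - {n - 1}.
              omega M powi (- int (i l)) - omega M powi (- int (i (n - 1))))) *
          omega M ^ i (n - 1))))"
proof -
  define w where "w = omega M"
  define z where "z = (\<lambda>k. w powi (- int (i k)))"
  define y where "y = (\<lambda>k. w ^ i k)"
  define L where "L = lagrange {..<P} z y"
  have w0: "w \<noteq> 0" by (simp add: w_def omega_def)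
  have z_inverse: "z k = inverse (w ^ i k)" for k
    by (simp add: z_def power_int_minus)
  \<comment> \<open>The hypothesis on the image of \<open>i\<close> places all indices below
    \<open>M\<close>, where powers of \<open>w\<close> are distinct.\<close>
  have "inj_on ((\<lambda>r. w ^ r) \<circ> i) {..<P}"
    using inj_on_omega_power[OF assms(1)] strict_mono_on_imp_inj_on[OF assms(3)] assms(4)
    by (intro comp_inj_on) (auto simp: w_def intro: inj_on_subset)
  then have inj: "inj_on z {..<P}" by (simp add: z_inverse inj_on_def)
  have "z p ^ l = w powi (- (int l * int (i p)))" for p l
    by (simp add: z_def power_int_power' mult.commute)
  then have sys: "spectral_system M P i K \<longleftrightarrow> (\<forall>l<P. K l = coeff L l)" for K
    using vandermonde_system_iff_coeff_lagrange[OF inj, of K y] assms(2)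
    by (simp add: spectral_system_def y_def L_def w_def)
  have unique: "\<exists>!K. K \<in> {..<P} \<rightarrow>\<^sub>E (UNIV :: complex set) \<and> spectral_system M P i K"
  proof
    \<comment> \<open>The system constrains \<open>K\<close> below \<open>P\<close>; extensionality
      fixes the remaining values as \<open>undefined\<close>, so that uniqueness holds for functions
      on all naturals.\<close>
    show "restrict (coeff L) {..<P} \<in> {..<P} \<rightarrow>\<^sub>E UNIV \<and> spectral_system M P i (restrict (coeff L) {..<P})"
      by (simp add: sys)
    show "K = restrict (coeff L) {..<P}"
      if "K \<in> {..<P} \<rightarrow>\<^sub>E UNIV \<and> spectral_system M P i K" for K
      using that by (auto simp: sys PiE_def extensional_def fun_eq_iff)
  qed
  have tuple: "(\<Prod>k\<in>set ks. z k) = w powi (- (\<Sum>k\<leftarrow>ks. int (i k)))"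
    if "ks \<in> increasing_tuples q A" for ks q A
  proof -
    \<comment> \<open>Adding negative exponents requires \<open>w0\<close>. A strictly sorted list
      has no repetitions, so its product is the product over its set.\<close>
    have "(\<Prod>k\<leftarrow>ks. z k) = w powi (- (\<Sum>k\<leftarrow>ks. int (i k)))"
      using w0 by (induction ks) (auto simp: z_def power_int_diff power_int_minus field_simps)
    with that show ?thesis
      by (simp add: increasing_tuples_def strict_sorted_iff prod.distinct_set_conv_list)
  qed
  have "K (m - 1) =
      (\<Sum>n=1..P. (-1) ^ (m + 1) *
        ((\<Sum>ks\<in>increasing_tuples (P - m) ({..<P} - {n - 1}). w powi (- (\<Sum>k\<leftarrow>ks. int (i k)))) /
         (\<Prod>l\<in>{..<P} - {n - 1}. z l - z (n - 1))) * y (n - 1))"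
    if "spectral_system M P i K" and m: "m \<in> {1..P}" for K m
  proof -
    have "K (m - 1) = coeff L (m - 1)" using that by (auto simp: sys)
    also have "\<dots> = (\<Sum>n<P. (-1) ^ (m - 1) *
        ((\<Sum>ks\<in>increasing_tuples (P - m) ({..<P} - {n}). \<Prod>k\<in>set ks. z k) /
         (\<Prod>l\<in>{..<P} - {n}. z l - z n)) * y n)"
      using m by (auto simp: L_def coeff_lagrange)
    also have "\<dots> = (\<Sum>n<P. (-1) ^ (m + 1) *
        ((\<Sum>ks\<in>increasing_tuples (P - m) ({..<P} - {n}). w powi (- (\<Sum>k\<leftarrow>ks. int (i k)))) /
         (\<Prod>l\<in>{..<P} - {n}. z l - z n)) * y n)"
      \<comment> \<open>As \<open>m\<close> is positive, the exponents \<open>m - 1\<close> and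
        \<open>m + 1\<close> differ by exactly two, so the signs agree.\<close>
      using m by (cases m) (simp_all add: tuple cong: sum.cong)
    also have "\<dots> = (\<Sum>n=1..P. (-1) ^ (m + 1) *
        ((\<Sum>ks\<in>increasing_tuples (P - m) ({..<P} - {n - 1}). w powi (- (\<Sum>k\<leftarrow>ks. int (i k)))) /
         (\<Prod>l\<in>{..<P} - {n - 1}. z l - z (n - 1))) * y (n - 1))"
      by (rule sum.reindex_bij_witness[where i = "\<lambda>n. n - 1" and j = Suc]) auto
    finally show ?thesis .
  qed
  with unique show ?thesis by (simp add: w_def z_def y_def)
qed

end
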